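(* Let $G$ be a $15$-tough $(P_{3}\cup 3P_{1})$-free graph on at least $3$ vertices. Then $G$ is hamiltonian.
   Context: All graphs are finite, simple and undirected. A cutset of $G$ is a set $S\subseteq V(G)$ such that $G-S$ is disconnected; $w(G-S)$ denotes the number of connected components of $G-S$. For a real $t\ge 0$, $G$ is $t$-tough if $|S|\ge t\cdot w(G-S)$ for every cutset $S$ of $G$ (so complete graphs are $t$-tough for every $t$). A graph is $R$-free if it contains no induced subgraph isomorphic to $R$. $P_3$ is the path on three vertices, and $P_{3}\cup 3P_{1}$ is the disjoint union of $P_3$ and three isolated vertices. A graph is hamiltonian if it has a cycle through all its vertices. *)

theory Defs
  imports Complex_Main "Graph_Theory.Graph_Theory"
begin

text \<open>
  Finite simple undirected graphs are the symmetric, loop-free digraphs without parallel arcs of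
  the locale \<^locale>\<open>graph\<close>: an edge is a pair of opposite arcs.
\<close>

definition components :: "('a, 'b) pre_digraph \<Rightarrow> ('a, 'b) pre_digraph set" where
  "components G = {H. pre_digraph.max_subgraph G Digraph_Component.connected H}"

definition delete_verts :: "('a, 'b) pre_digraph \<Rightarrow> 'a set \<Rightarrow> ('a, 'b) pre_digraph" where
  "delete_verts G S = G \<restriction> (verts G - S)"

text \<open>
  \<^const>\<open>Digraph_Component.connected\<close> is false for the graph without vertices. The inclusion is
  strict so that the whole vertex set is not a cutset.
\<close>

definition cutset :: "('a, 'b) pre_digraph \<Rightarrow> 'a set \<Rightarrow> bool" where
  "cutset G S \<longleftrightarrow> S \<subset> verts G \<and> \<not> Digraph_Component.connected (delete_verts G S)"

definition tough :: "real \<Rightarrow> ('a, 'b) pre_digraph \<Rightarrow> bool" where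
  "tough t G \<longleftrightarrow>
     (\<forall>S. cutset G S \<longrightarrow> real (card S) \<ge> t * real (card (components (delete_verts G S))))"

definition induced_free :: "('c, 'd) pre_digraph \<Rightarrow> ('a, 'b) pre_digraph \<Rightarrow> bool" where
  "induced_free R G \<longleftrightarrow> \<not> (\<exists>H. induced_subgraph H G \<and> digraph_iso H R)"

text \<open>The path is 0 - 1 - 2; the vertices 3, 4 and 5 are isolated.\<close>

definition P3_union_3P1 :: "nat pair_pre_digraph" where
  "P3_union_3P1 = \<lparr> pverts = {0, 1, 2, 3, 4, 5}, parcs = {(0, 1), (1, 0), (1, 2), (2, 1)} \<rparr>"

text \<open>
  \<^const>\<open>pre_digraph.cycle\<close> also admits the closed walk that traverses one edge back and
  forth, which is not a cycle of an undirected graph; the length bound excludes it.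
\<close>

definition hamiltonian :: "('a, 'b) pre_digraph \<Rightarrow> bool" where
  "hamiltonian G \<longleftrightarrow>
     (\<exists>p. pre_digraph.cycle G p \<and> 3 \<le> length p \<and> tail G ` set p = verts G)"

end

theory Submission
  imports Defs
begin

text \<open>
  Suppose a longest cycle \<open>C\<close> misses a vertex \<open>v\<close>, let \<open>H\<close> be the component of \<open>v\<close> in \<open>G - C\<close>, and
  let \<open>N\<close> be the set of vertices of \<open>C\<close> with a neighbour in \<open>H\<close>. No path through all of \<open>C\<close> that
  avoids \<open>H\<close> has both ends in \<open>N\<close>, since it could be closed up through \<open>H\<close>. Hence
  \<open>A = {v} \<union> N\<^sup>+\<close> is independent, where \<open>x\<^sup>+\<close> is the successor of \<open>x\<close> on \<open>C\<close>, and \<open>|N| \<ge> 15\<close>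
  because \<open>N\<close> is a cutset.

  Let \<open>B\<close> be the set of vertices with at least two neighbours in \<open>A\<close>. As \<open>G\<close> is
  \<open>(P\<^sub>3 \<union> 3P\<^sub>1)\<close>-free, every vertex of \<open>B\<close> misses at most two vertices of \<open>A\<close>, and \<open>G - B\<close> is
  \<open>P\<^sub>3\<close>-free, that is, a disjoint union of cliques. Maximality of \<open>C\<close> gives \<open>B \<subseteq> C\<close>, and the crossing
  argument gives \<open>b\<^sup>+ \<notin> B\<close> for \<open>b \<in> B\<close>. By toughness \<open>B\<close> has more vertices than \<open>G - B\<close> has
  components, so \<open>b\<^sup>+\<close> and \<open>b'\<^sup>+\<close> lie in the same clique for some distinct \<open>b, b' \<in> B\<close>. The edge
  \<open>b\<^sup>+ b'\<^sup>+\<close> turns \<open>C\<close> into a path from \<open>b\<close> to \<open>b'\<close>, to which the crossing argument applies again.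
\<close>

unbundle no funcset_syntax

subsection \<open>Components, toughness and forbidden subgraphs\<close>

context wf_digraph
begin

text \<open>The clause on \<open>set p\<close> keeps the path inside the reachability class of
  \<open>x\<close>, which later places it inside \<open>H\<close>. A path that already visits the
  new vertex is cut there, so it stays simple.\<close>

lemma reachable_simple_path:
  assumes "x \<rightarrow>\<^sup>* y"
  shows "\<exists>p. p \<noteq> [] \<and> hd p = x \<and> last p = y \<and> distinct p \<and> set p \<subseteq> {z. x \<rightarrow>\<^sup>* z}
    \<and> successively (dominates G) p"
  using assms
proof (induction rule: reachable_induct)
  case base
  then show ?case by (intro exI[of _ "[x]"]) auto
next
  case (step y z)
  then obtain p where p: "p \<noteq> []" "hd p = x" "last p = y" "distinct p" "set p \<subseteq> {z. x \<rightarrow>\<^sup>* z}"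
    "successively (dominates G) p" by blast
  show ?case
  proof (cases "z \<in> set p")
    case True
    then obtain us vs where "p = us @ z # vs" by (auto dest: split_list)
    then show ?thesis
      using p by (intro exI[of _ "us @ [z]"]) (auto simp: successively_append_iff hd_append)
  next
    case False
    moreover have "x \<rightarrow>\<^sup>* z" using step by (meson reachable_adj_trans)
    ultimately show ?thesis
      using p \<open>y \<rightarrow> z\<close> by (intro exI[of _ "p @ [z]"]) (auto simp: successively_append_iff)
  qed
qed

lemma delete_verts_adj_iff:
  "u \<rightarrow>\<^bsub>delete_verts G S\<^esub> v \<longleftrightarrow> u \<rightarrow> v \<and> u \<notin> S \<and> v \<notin> S"
  by (force simp: delete_verts_def arcs_ends_conv)

end

section \<open>Components after vertex deletion\<close>

lemma verts_delete_verts [simp]: "verts (delete_verts G S) = verts G - S"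
  by (simp add: delete_verts_def)

text \<open>A component inherits \<open>tail\<close> and \<open>head\<close> from \<open>G\<close>,
  so its vertex and arc sets determine it. Finiteness matters because \<open>card\<close> of an
  infinite set is 0.\<close>

lemma (in fin_digraph) finite_components: "finite (components G)"
proof -
  let ?f = "\<lambda>H :: ('a, 'b) pre_digraph. (verts H, arcs H)"
  have "?f ` components G \<subseteq> Pow (verts G) \<times> Pow (arcs G)"
    by (auto simp: components_def max_subgraph_def)
  moreover have "inj_on ?f (components G)"
  proof (rule inj_onI)
    fix H K assume "H \<in> components G" "K \<in> components G" and eq: "?f H = ?f K"
    then have "compatible G H" "compatible G K"
      by (auto simp: components_def max_subgraph_def)
    with eq show "H = K"
      by (intro pre_digraph.equality) (auto simp: compatible_def)
  qed
  ultimately show ?thesis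
    using finite_imageD[of ?f "components G"] by (meson finite_Pow_iff finite_SigmaI finite_arcs finite_subset finite_verts)
qed

text \<open>A connected subgraph containing \<open>u\<close> cannot leave the class, and the induced
  subgraph already has every arc inside it.\<close>

lemma (in sym_digraph) reachable_class_component:
  assumes u: "u \<in> verts G"
  shows "G \<restriction> {v. u \<rightarrow>\<^sup>* v} \<in> components G"
proof -
  let ?K = "{v. u \<rightarrow>\<^sup>* v}"
  let ?H = "G \<restriction> ?K"
  have K: "?K \<subseteq> verts G" by (auto elim: reachable_in_vertsE)
  have sub: "subgraph ?H G" using K by (rule subgraph_induce_subgraphI)
  interpret H: wf_digraph ?H by auto
  have symH: "symmetric ?H"
    using K sym_arcs by (meson induced_graph_imp_symmetric induced_induce)
  have reach: "u \<rightarrow>\<^sup>*\<^bsub>?H\<^esub> v" if "v \<in> ?K" for v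
    using that by (auto intro: induce_reachable_preserves_paths)
  have conn: "Digraph_Component.connected ?H"
  proof (rule H.connectedI)
    fix v w assume "v \<in> verts ?H" "w \<in> verts ?H"
    then have "v \<rightarrow>\<^sup>*\<^bsub>?H\<^esub> u" "u \<rightarrow>\<^sup>*\<^bsub>?H\<^esub> w"
      using reach symmetric_reachable[OF symH] by auto
    then show "v \<rightarrow>\<^sup>*\<^bsub>mk_symmetric ?H\<^esub> w"
      by (meson H.reachable_mk_symmetricI H.reachable_trans)
  qed (use u in auto)
  have "H' = ?H" if H': "subgraph ?H H'" "subgraph H' G" "Digraph_Component.connected H'" for H'
  proof -
    have "verts H' \<subseteq> ?K"
    proof
      fix v assume "v \<in> verts H'"
      moreover have "u \<in> verts H'" using subgraph_imp_subverts[OF H'(1)] u by auto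
      ultimately have "u \<rightarrow>\<^sup>*\<^bsub>mk_symmetric H'\<^esub> v"
        using H'(3) by (auto simp: connected_def strongly_connected_def)
      then have "u \<rightarrow>\<^sup>*\<^bsub>mk_symmetric G\<^esub> v"
        by (rule pre_digraph.reachable_mono) (rule subgraph_mk_symmetric[OF H'(2)])
      then show "v \<in> ?K" using sym_arcs by (simp add: reachable_mk_symmetric_eq)
    qed
    then have V: "verts H' = ?K" using H'(1) by auto
    have c: "tail H' = tail G" "head H' = head G" using H'(2) by (auto simp: compatible_def)
    interpret H': wf_digraph H' using H'(2) by auto
    have "arcs H' \<subseteq> arcs ?H"
      using H'(2) V H'.tail_in_verts H'.head_in_verts c by fastforce
    then have "arcs H' = arcs ?H" using H'(1) unfolding subgraph_def by blast
    then show "H' = ?H" using V c by (intro pre_digraph.equality) auto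
  qed
  then show ?thesis using sub conn by (auto simp: components_def max_subgraph_def)
qed

lemma (in graph) graph_delete_verts: "graph (delete_verts G S)"
proof -
  have ind: "induced_subgraph (delete_verts G S) G" by (auto simp: delete_verts_def)
  interpret D: digraph "delete_verts G S" by (rule digraphI_induced[OF ind])
  show ?thesis
    using induced_graph_imp_symmetric[OF sym_arcs ind] by (rule D.graphI)
qed

lemma (in graph) tough_separated:
  assumes "tough t G" and xy: "x \<in> verts G - S" "y \<in> verts G - S"
    and "S \<subseteq> verts G" "\<not> x \<rightarrow>\<^sup>*\<^bsub>delete_verts G S\<^esub> y"
  shows "t * card (components (delete_verts G S)) \<le> card S"
proof -
  interpret D: graph "delete_verts G S" by (rule graph_delete_verts)
  have "\<not> Digraph_Component.connected (delete_verts G S)"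
    using assms D.symmetric_connected_imp_strongly_connected[OF D.sym_arcs]
    by (auto simp: strongly_connected_def)
  then have "cutset G S" using xy \<open>S \<subseteq> verts G\<close> by (auto simp: cutset_def)
  then show ?thesis using \<open>tough t G\<close> by (auto simp: tough_def)
qed

lemma (in graph) card_components_delete_verts_pos:
  assumes "x \<in> verts G - S"
  shows "0 < card (components (delete_verts G S))"
proof -
  interpret D: graph "delete_verts G S" by (rule graph_delete_verts)
  show ?thesis
    using D.reachable_class_component[of x] D.finite_components assms
    by (auto simp: card_gt_0_iff)
qed

text \<open>Any three members of \<open>D\<close> serve as the isolated vertices beside the path
  \<open>p\<close>, \<open>q\<close>, \<open>r\<close>; the work is to build the
  isomorphism.\<close>

lemma (in graph) P3_union_3P1_free_forbidden:
  assumes free: "induced_free (with_proj P3_union_3P1) G"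
    and adj: "p \<rightarrow> q" "q \<rightarrow> r" and nadj: "p \<noteq> r" "\<not> p \<rightarrow> r"
    and D: "D \<subseteq> verts G" "3 \<le> card D" "\<And>d e. d \<in> D \<Longrightarrow> e \<in> D \<Longrightarrow> \<not> d \<rightarrow> e"
      "\<And>d u. d \<in> D \<Longrightarrow> u \<in> {p, q, r} \<Longrightarrow> d \<noteq> u \<and> \<not> u \<rightarrow> d"
  shows False
proof -
  obtain D' where "D' \<subseteq> D" "card D' = 3" using D(2) by (meson obtain_subset_with_card_n)
  then obtain d e f where def: "d \<in> D" "e \<in> D" "f \<in> D" "d \<noteq> e" "d \<noteq> f" "e \<noteq> f"
    by (auto simp: card_3_iff)
  let ?vs = "{p, q, r, d, e, f}"
  define H where "H = G \<restriction> ?vs"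
  have pqr: "p \<in> verts G" "q \<in> verts G" "r \<in> verts G" using adj by (auto dest: adj_in_verts)
  then have vs: "?vs \<subseteq> verts G" using D(1) def by auto
  have sym: "v \<rightarrow> u \<longleftrightarrow> u \<rightarrow> v" for u v using graph_symmetric by blast
  have "q \<noteq> p" "q \<noteq> r" using adj adj_not_same by auto
  then have dist: "distinct [p, q, r, d, e, f]" using def nadj D(4) by auto
  \<comment> \<open>Numbers the six vertices as in \<open>P3_union_3P1\<close>; the default value 5
    is the number of \<open>f\<close>.\<close>
  define g :: "'a \<Rightarrow> nat" where
    "g v = (if v = p then 0 else if v = q then 1 else if v = r then 2
       else if v = d then 3 else if v = e then 4 else 5)" for v
  have g: "g p = 0" "g q = 1" "g r = 2" "g d = 3" "g e = 4" "g f = 5"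
    using dist by (auto simp: g_def)
  define m where "m = \<lparr>iso_verts = g, iso_arcs = (\<lambda>a. (g (tail G a), g (head G a))),
     iso_head = snd, iso_tail = fst\<rparr>"
  have wfH: "wf_digraph H" by (auto simp: H_def)
  have injg: "inj_on g ?vs" using g by (auto simp: inj_on_def)
  have arcsH: "arcs H = {a \<in> arcs G. tail G a \<in> ?vs \<and> head G a \<in> ?vs}" by (simp add: H_def)
  \<comment> \<open>An arc is determined by its ends, since \<open>G\<close> has no parallel
    arcs.\<close>
  have inja: "inj_on (iso_arcs m) (arcs H)"
  proof (rule inj_onI)
    fix a b assume "a \<in> arcs H" "b \<in> arcs H" "iso_arcs m a = iso_arcs m b"
    then have ab: "a \<in> arcs G" "b \<in> arcs G" "tail G a \<in> ?vs" "tail G b \<in> ?vs"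
      "head G a \<in> ?vs" "head G b \<in> ?vs" "g (tail G a) = g (tail G b)" "g (head G a) = g (head G b)"
      by (simp_all add: arcsH m_def)
    then have "tail G a = tail G b" "head G a = head G b"
      using inj_onD[OF injg] by blast+
    then show "a = b" using no_multi_arcs[OF ab(1,2)] by (simp add: arc_to_ends_def)
  qed
  have iso: "pre_digraph.digraph_isomorphism H m"
    unfolding pre_digraph.digraph_isomorphism_def
  proof (intro conjI)
    show "inj_on (iso_verts m) (verts H)" using injg by (simp add: m_def H_def)
    show "\<forall>a\<in>arcs H. iso_verts m (tail H a) = iso_tail m (iso_arcs m a) \<and>
        iso_verts m (head H a) = iso_head m (iso_arcs m a)"
      by (simp add: m_def H_def)
  qed (fact wfH inja)+
  have ends: "arcs_ends G \<inter> ?vs \<times> ?vs = {(p, q), (q, p), (q, r), (r, q)}"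
  proof (rule set_eqI, rule iffI)
    fix z assume z: "z \<in> arcs_ends G \<inter> ?vs \<times> ?vs"
    obtain x y where xy: "z = (x, y)" by (cases z)
    have far: "\<not> u \<rightarrow> w" "\<not> w \<rightarrow> u" if "w \<in> {d, e, f}" "u \<in> ?vs" for u w
    proof -
      have "w \<in> D" using that(1) def by blast
      moreover have "u \<in> D \<or> u \<in> {p, q, r}" using that(2) def by blast
      ultimately show "\<not> u \<rightarrow> w" using D(3,4) by blast
      then show "\<not> w \<rightarrow> u" using sym by blast
    qed
    then have "x \<in> {p, q, r}" "y \<in> {p, q, r}" "x \<rightarrow> y" using z xy by blast+
    moreover have "\<not> r \<rightarrow> p" using nadj(2) sym by blast
    ultimately show "z \<in> {(p, q), (q, p), (q, r), (r, q)}"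
      using nadj(2) adj_not_same unfolding xy by blast
  next
    fix z assume "z \<in> {(p, q), (q, p), (q, r), (r, q)}"
    moreover have "q \<rightarrow> p" "r \<rightarrow> q" using adj sym by blast+
    ultimately show "z \<in> arcs_ends G \<inter> ?vs \<times> ?vs" using adj by blast
  qed
  have "iso_arcs m ` arcs H = (\<lambda>z. (g (fst z), g (snd z))) ` (arcs_ends G \<inter> ?vs \<times> ?vs)"
  proof -
    have "arcs_ends G \<inter> W \<times> W = (\<lambda>a. (tail G a, head G a)) ` {a \<in> arcs G. tail G a \<in> W \<and> head G a \<in> W}" for W
      by (auto simp: arcs_ends_conv)
    then show ?thesis unfolding arcsH by (simp only: image_image) (simp add: m_def)
  qed
  also note ends
  also have "(\<lambda>z. (g (fst z), g (snd z))) ` {(p, q), (q, p), (q, r), (r, q)} = {(0, 1), (1, 0), (1, 2), (2, 1)}" by (simp add: g)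
  finally have "app_iso m H = with_proj P3_union_3P1"
    by (intro pre_digraph.equality) (simp_all add: P3_union_3P1_def H_def m_def g)
  then have "digraph_iso H (with_proj P3_union_3P1)"
    using iso unfolding digraph_iso_def by metis
  moreover have "induced_subgraph H G" using vs by (auto simp: H_def)
  ultimately show False using free by (auto simp: induced_free_def)
qed

subsection \<open>Longest cycles\<close>

text \<open>The cyclic successor: appending \<open>xs\<close> makes the last entry wrap around to
  the first.\<close>

definition nxt :: "'a list \<Rightarrow> 'a \<Rightarrow> 'a" where
  "nxt xs x = hd (tl (dropWhile (\<lambda>z. z \<noteq> x) xs) @ xs)"

lemma nxt_append:
  assumes "distinct (us @ vs)" "us \<noteq> []"
  shows "nxt (us @ vs) (last us) = hd (vs @ us)"
proof -
  obtain as x where us: "us = as @ [x]" using assms(2) by (metis rev_exhaust)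
  have "dropWhile (\<lambda>z. z \<noteq> x) (as @ x # vs) = x # vs" if "x \<notin> set as"
    using that by (induction as) auto
  then show ?thesis using assms(1) us by (cases vs) (auto simp: nxt_def)
qed

lemma nxt_rotate:
  assumes "distinct (us @ vs)" "x \<in> set (us @ vs)"
  shows "nxt (vs @ us) x = nxt (us @ vs) x"
proof -
  consider as bs where "us = as @ x # bs" | as bs where "vs = as @ x # bs"
    using assms(2) by (auto dest: split_list)
  then show ?thesis
  proof cases
    case 1
    then show ?thesis
      using assms(1) nxt_append[of "as @ [x]" "bs @ vs"] nxt_append[of "vs @ as @ [x]" bs] by auto
  next
    case 2
    then show ?thesis
      using assms(1) nxt_append[of "us @ as @ [x]" bs] nxt_append[of "as @ [x]" "bs @ us"] by auto
  qed
qed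

text \<open>Single vertices and single edges count as cycles here, so that a longest one exists without
  further argument; connectivity rules them out later.\<close>

definition (in pre_digraph) vcycle :: "'a list \<Rightarrow> bool" where
  "vcycle xs \<longleftrightarrow> xs \<noteq> [] \<and> distinct xs \<and> set xs \<subseteq> verts G \<and> successively (dominates G) xs
     \<and> (length xs = 1 \<or> last xs \<rightarrow> hd xs)"

lemma (in wf_digraph) vcycle_rotate:
  assumes "vcycle (us @ vs)"
  shows "vcycle (vs @ us)"
proof (cases "us = [] \<or> vs = []")
  case False
  then have "length (us @ vs) \<noteq> 1" by (cases us; cases vs) auto
  then show ?thesis using assms False by (auto simp: vcycle_def successively_append_iff)
qed (use assms in auto)

lemma (in sym_digraph) successively_adj_rev:
  assumes "successively (dominates G) xs"
  shows "successively (dominates G) (rev xs)"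
  using assms graph_symmetric by (auto simp: successively_rev elim!: successively_mono)

text \<open>\<open>H\<close> stands for a component of \<open>G\<close> minus the cycle. The cycle
  arguments take from it a simple path inside \<open>H\<close> between any two of its vertices, a
  single vertex when they coincide.\<close>

locale longest_vcycle = graph +
  fixes C :: "'a list" and H :: "'a set"
  assumes vcycle_C: "vcycle C"
    and longest: "vcycle D \<Longrightarrow> length D \<le> length C"
    and H_verts: "H \<subseteq> verts G - set C"
    and H_path: "x \<in> H \<Longrightarrow> y \<in> H \<Longrightarrow>
      \<exists>p. p \<noteq> [] \<and> hd p = x \<and> last p = y \<and> distinct p \<and> set p \<subseteq> H \<and> successively (dominates G) p"
begin

definition attach :: "'a set" where
  "attach = {x \<in> set C. \<exists>h\<in>H. x \<rightarrow> h}"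

abbreviation succ :: "'a \<Rightarrow> 'a" where
  "succ \<equiv> nxt C"

text \<open>Describes \<open>C\<close> cut open at another edge by its successor map rather than by
  a shift, so that \<open>succ\<close> can be read off any such list.\<close>

definition rotation :: "'a list \<Rightarrow> bool" where
  "rotation D \<longleftrightarrow> vcycle D \<and> set D = set C \<and> (\<forall>x\<in>set C. nxt D x = succ x)"

lemma distinct_C: "distinct C"
  using vcycle_C by (simp add: vcycle_def)

lemma attach_subset: "attach \<subseteq> set C"
  by (auto simp: attach_def)

lemma finite_attach: "finite attach"
  by (simp add: attach_def)

text \<open>A path in \<open>H\<close> joining neighbours of the two ends closes \<open>P\<close> to
  a cycle longer than \<open>C\<close>. \<open>P\<close> may also use vertices outside both
  \<open>C\<close> and \<open>H\<close>. If \<open>P\<close> is a single vertex the result may be a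
  single edge, which \<open>vcycle\<close> admits.\<close>

lemma no_spanning_path:
  assumes P: "distinct P" "successively (dominates G) P" "set C \<subseteq> set P" "set P \<subseteq> verts G - H"
    and ends: "hd P \<in> attach" "last P \<in> attach"
  shows False
proof -
  obtain h k where hk: "h \<in> H" "k \<in> H" "last P \<rightarrow> h" "hd P \<rightarrow> k"
    using ends by (auto simp: attach_def)
  obtain p where p: "p \<noteq> []" "hd p = h" "last p = k" "distinct p" "set p \<subseteq> H"
    "successively (dominates G) p" using H_path hk by blast
  have "P \<noteq> []" using P(3) vcycle_C by (auto simp: vcycle_def)
  then have "vcycle (P @ p)"
    using P p hk H_verts graph_symmetric by (auto simp: vcycle_def successively_append_iff)
  moreover have "length C \<le> length P"
    using P(1,3) distinct_C by (metis card_mono distinct_card finite_set)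
  ultimately show False using longest[of "P @ p"] p(1) by (cases p) auto
qed

section \<open>Rotations and the successor map\<close>

lemma rotation_rotate:
  assumes D: "rotation (us @ vs)"
  shows "rotation (vs @ us)"
proof -
  have "distinct (us @ vs)" using D by (simp only: rotation_def vcycle_def)
  then have "nxt (vs @ us) x = succ x" if "x \<in> set C" for x
    using D that nxt_rotate[of us vs x] by (simp add: rotation_def)
  moreover have "set (vs @ us) = set C" using D by (auto simp: rotation_def)
  ultimately show ?thesis using D vcycle_rotate unfolding rotation_def by blast
qed

lemma rotation_split:
  assumes "rotation D" "x \<in> set C" "x \<noteq> last D"
  obtains us vs where "D = us @ vs" "us \<noteq> []" "vs \<noteq> []" "last us = x" "hd vs = succ x"
proof -
  have "x \<in> set D" using assms(1,2) by (simp add: rotation_def)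
  then obtain as bs where D: "D = as @ x # bs" by (meson split_list)
  then have "bs \<noteq> []" using assms(3) by auto
  moreover have "nxt D x = hd bs"
    using nxt_append[of "as @ [x]" bs] assms(1) D \<open>bs \<noteq> []\<close> by (auto simp: rotation_def vcycle_def)
  ultimately show ?thesis
    using that[of "as @ [x]" bs] D assms(1,2) by (simp add: rotation_def)
qed

lemma rotation_hd:
  assumes "rotation D"
  shows "hd D = succ (last D)"
proof -
  have "last D \<in> set C" "distinct D" "D \<noteq> []"
    using assms last_in_set[of D] by (auto simp: rotation_def vcycle_def)
  then show ?thesis using assms nxt_append[of D "[]"] by (simp add: rotation_def)
qed

lemma rotation_last:
  assumes "x \<in> set C"
  obtains D where "rotation D" "last D = x"
proof -
  obtain as bs where C: "C = as @ x # bs" using assms by (auto dest: split_list)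
  have "rotation C" using vcycle_C by (simp add: rotation_def)
  then have "rotation ((as @ [x]) @ bs)" unfolding C by simp
  then have "rotation (bs @ as @ [x])" by (rule rotation_rotate)
  then show ?thesis using that by force
qed

lemma rotationD:
  assumes "rotation D"
  shows "D \<noteq> []" "distinct D" "successively (dominates G) D" "set D = set C"
    "set D \<subseteq> verts G - H"
  using assms H_verts by (auto simp: rotation_def vcycle_def)

lemma succ_in: "x \<in> set C \<Longrightarrow> succ x \<in> set C"
  by (metis hd_in_set rotationD(1,4) rotation_hd rotation_last)

text \<open>In the rotation ending in \<open>x\<close>, \<open>succ x\<close> comes first, whereas
  \<open>succ y\<close> is preceded by \<open>y\<close>.\<close>

lemma inj_on_succ: "inj_on succ (set C)"
proof (rule inj_onI, rule ccontr)
  fix x y assume xy: "x \<in> set C" "y \<in> set C" "succ x = succ y" "x \<noteq> y"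
  obtain D where D: "rotation D" "last D = x" using rotation_last xy by blast
  then obtain us vs where "D = us @ vs" "us \<noteq> []" "vs \<noteq> []" "last us = y" "hd vs = succ y"
    using rotation_split[OF D(1) xy(2)] xy(4) by blast
  moreover have "hd D = succ x" using rotation_hd D by blast
  ultimately show False
    using rotationD(2)[OF D(1)] xy(3) hd_in_set[of us] hd_in_set[of vs] by (auto simp: disjoint_iff)
qed

text \<open>Cut open between \<open>x\<close> and its successor, \<open>C\<close> is itself a
  spanning path with these two ends.\<close>

lemma succ_not_attach:
  assumes "x \<in> attach"
  shows "succ x \<notin> attach"
proof
  assume "succ x \<in> attach"
  have "x \<in> set C" using assms by (simp add: attach_def)
  then obtain D where D: "rotation D" "last D = x" by (rule rotation_last)
  then show False
    using no_spanning_path[of D] rotationD[OF D(1)] rotation_hd[OF D(1)] assms \<open>succ x \<in> attach\<close>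
    by auto
qed

section \<open>Edges excluded between successors\<close>

lemma successors_split:
  assumes "x \<in> set C" "y \<in> set C" "x \<noteq> y"
  obtains us vs where "rotation (us @ vs)" "us \<noteq> []" "vs \<noteq> []"
    "last us = y" "last vs = x" "hd us = succ x" "hd vs = succ y"
proof -
  obtain D where D: "rotation D" "last D = x" using rotation_last assms by blast
  then obtain us vs where usvs: "D = us @ vs" "us \<noteq> []" "vs \<noteq> []" "last us = y" "hd vs = succ y"
    using rotation_split[OF D(1)] assms by blast
  show ?thesis
    by (rule that[of us vs]) (use usvs D rotation_hd[OF D(1)] in auto)
qed

text \<open>With such an edge, going back from \<open>x\<close> to \<open>succ y\<close>, across to
  \<open>succ x\<close> and forward to \<open>y\<close> is a forbidden spanning path.\<close>

lemma successors_not_adj: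
  assumes xy: "x \<in> attach" "y \<in> attach"
  shows "\<not> succ x \<rightarrow> succ y"
proof
  assume adj: "succ x \<rightarrow> succ y"
  then have "x \<noteq> y" using adj_not_same by auto
  then obtain us vs where D: "rotation (us @ vs)" and usvs: "us \<noteq> []" "vs \<noteq> []"
    "last us = y" "last vs = x" "hd us = succ x" "hd vs = succ y"
    using successors_split[of x y] xy attach_subset by blast
  show False
  proof (rule no_spanning_path)
    show "successively (dominates G) (rev vs @ us)"
      using successively_adj_rev[of vs] rotationD(3)[OF D] usvs adj graph_symmetric
      by (auto simp: successively_append_iff last_rev)
  qed (use rotationD[OF D] usvs xy in \<open>auto simp: hd_rev\<close>)
qed

text \<open>The path used for adjacent successors, with the edge between them replaced by a detour
  through \<open>u\<close>.\<close>

lemma outside_adj_successors: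
  assumes xy: "x \<in> attach" "y \<in> attach" "x \<noteq> y"
    and u: "u \<in> verts G" "u \<notin> set C" "u \<notin> H" "u \<rightarrow> succ x"
  shows "\<not> u \<rightarrow> succ y"
proof
  assume adj: "u \<rightarrow> succ y"
  obtain us vs where D: "rotation (us @ vs)" and usvs: "us \<noteq> []" "vs \<noteq> []"
    "last us = y" "last vs = x" "hd us = succ x" "hd vs = succ y"
    using successors_split[of x y] xy attach_subset by blast
  show False
  proof (rule no_spanning_path)
    show "successively (dominates G) (rev vs @ u # us)"
      using successively_adj_rev[of vs] rotationD(3)[OF D] usvs adj u(4) graph_symmetric
      by (auto simp: successively_append_iff successively_Cons last_rev)
    show "distinct (rev vs @ u # us)" using rotationD(2,4)[OF D] u(2) by auto
  qed (use rotationD[OF D] usvs xy u in \<open>auto simp: hd_rev\<close>)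
qed

text \<open>If \<open>P\<close> runs \<open>s \<dots> x, x\<^sup>+ \<dots> y, y\<^sup>+ \<dots> t\<close> with \<open>x, y\<close> attached to \<open>H\<close>, and \<open>s\<close> is adjacent to
  \<open>y\<^sup>+\<close> and \<open>t\<close> to \<open>x\<^sup>+\<close>, then \<open>x \<dots> s, y\<^sup>+ \<dots> t, x\<^sup>+ \<dots> y\<close> is a path from \<open>x\<close> to \<open>y\<close> through all
  of \<open>C\<close>. At most four of the successors are missed by one of \<open>s, t\<close>, so six candidates leave
  such a pair.\<close>

lemma no_crossing:
  assumes P: "distinct P" "successively (dominates G) P" "set P = set C"
    and X: "X \<subseteq> attach"
    and split: "\<And>x. x \<in> X \<Longrightarrow> \<exists>us vs. P = us @ vs \<and> us \<noteq> [] \<and> vs \<noteq> [] \<and> last us = x \<and> hd vs = succ x"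
    and few: "card {a \<in> succ ` attach. \<not> hd P \<rightarrow> a} \<le> 2" "card {a \<in> succ ` attach. \<not> last P \<rightarrow> a} \<le> 2"
  shows "card X \<le> 5"
proof (rule ccontr)
  assume "\<not> card X \<le> 5"
  let ?Y = "{x \<in> X. hd P \<rightarrow> succ x \<and> last P \<rightarrow> succ x}"
  have crossing: False
    if x: "x \<in> ?Y" and y: "y \<in> ?Y" and us: "P = us @ vs" "us \<noteq> []" "vs \<noteq> []" "last us = x" "hd vs = succ x"
      and us': "P = us' @ vs'" "us' \<noteq> []" "vs' \<noteq> []" "last us' = y" "hd vs' = succ y"
      and less: "length us < length us'" for x y us vs us' vs'
  proof -
    \<comment> \<open>\<open>ms\<close> is the segment of \<open>P\<close> from
      \<open>succ x\<close> to \<open>y\<close>.\<close>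
    from us(1) us'(1) less obtain ms where ms: "us' = us @ ms" "vs = ms @ vs'" "ms \<noteq> []"
      by (auto simp: append_eq_append_conv2)
    show False
    proof (rule no_spanning_path)
      show "successively (dominates G) (rev us @ vs' @ ms)"
        using successively_adj_rev[of us] P(2) us us' x y ms graph_symmetric
        by (auto simp: successively_append_iff last_rev)
    qed (use P H_verts x y us us' ms X vcycle_C in \<open>auto simp: hd_rev vcycle_def\<close>)
  qed
  have fin: "finite X" using X finite_attach finite_subset by blast
  \<comment> \<open>Since \<open>succ\<close> is injective, each missed successor costs only one
    vertex of \<open>X\<close>.\<close>
  have bad: "card {x \<in> X. \<not> u \<rightarrow> succ x} \<le> 2" if "card {a \<in> succ ` attach. \<not> u \<rightarrow> a} \<le> 2" for u
  proof -
    have "inj_on succ {x \<in> X. \<not> u \<rightarrow> succ x}"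
      by (rule inj_on_subset[OF inj_on_succ]) (use X attach_subset in auto)
    moreover have "succ ` {x \<in> X. \<not> u \<rightarrow> succ x} \<subseteq> {a \<in> succ ` attach. \<not> u \<rightarrow> a}" using X by auto
    moreover have "finite {a \<in> succ ` attach. \<not> u \<rightarrow> a}" using finite_attach by simp
    ultimately show ?thesis using card_inj_on_le that le_trans by blast
  qed
  have "X \<subseteq> ?Y \<union> ({x \<in> X. \<not> hd P \<rightarrow> succ x} \<union> {x \<in> X. \<not> last P \<rightarrow> succ x})" by auto
  then have "card X \<le> card (?Y \<union> ({x \<in> X. \<not> hd P \<rightarrow> succ x} \<union> {x \<in> X. \<not> last P \<rightarrow> succ x}))"
    using fin by (intro card_mono) auto
  also have "\<dots> \<le> card ?Y + (card {x \<in> X. \<not> hd P \<rightarrow> succ x} + card {x \<in> X. \<not> last P \<rightarrow> succ x})"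
    using card_Un_le by (meson add_left_mono le_trans)
  finally have "2 \<le> card ?Y" using bad[OF few(1)] bad[OF few(2)] \<open>\<not> card X \<le> 5\<close> by linarith
  then obtain Y where "Y \<subseteq> ?Y" "card Y = 2" by (meson obtain_subset_with_card_n)
  then obtain x y where xy: "x \<in> ?Y" "y \<in> ?Y" "x \<noteq> y" by (auto simp: card_2_iff)
  obtain us vs where us: "P = us @ vs" "us \<noteq> []" "vs \<noteq> []" "last us = x" "hd vs = succ x"
    using split xy(1) by blast
  obtain us' vs' where us': "P = us' @ vs'" "us' \<noteq> []" "vs' \<noteq> []" "last us' = y" "hd vs' = succ y"
    using split xy(2) by blast
  have "length us \<noteq> length us'" using us us' xy(3) by auto
  then show False
    using crossing[OF xy(1,2) us us'] crossing[OF xy(2,1) us' us] by linarith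
qed

text \<open>The bound 2 is what forbidding \<open>P3_union_3P1\<close> gives for the vertices of the
  set \<open>B\<close> of the main argument.\<close>

definition dominating :: "'a \<Rightarrow> bool" where
  "dominating b \<longleftrightarrow> b \<in> set C \<and> card {a \<in> succ ` attach. \<not> b \<rightarrow> a} \<le> 2"

text \<open>The rotation ending in \<open>b\<close> starts in \<open>succ b\<close>, so both ends of
  this path are dominating. The last vertex \<open>b\<close> has no successor along the path and is
  left out, whence 5 + 1.\<close>

lemma dominating_succ:
  assumes b: "dominating b" "dominating (succ b)"
  shows "card attach \<le> 6"
proof -
  obtain D where D: "rotation D" "last D = b"
    using b(1) rotation_last by (auto simp: dominating_def)
  have "card (attach - {b}) \<le> 5"
  proof (rule no_crossing)
    fix x assume "x \<in> attach - {b}"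
    then have "x \<in> set C" "x \<noteq> last D" using attach_subset D(2) by auto
    then show "\<exists>us vs. D = us @ vs \<and> us \<noteq> [] \<and> vs \<noteq> [] \<and> last us = x \<and> hd vs = succ x"
      by (metis rotation_split[OF D(1)])
  qed (use rotationD[OF D(1)] D b rotation_hd[OF D(1)] in \<open>auto simp: dominating_def\<close>)
  then show ?thesis using finite_attach by (simp add: card_Diff_singleton_if split: if_splits)
qed

text \<open>Exchanging the edges \<open>b b\<^sup>+\<close> and \<open>b' b'\<^sup>+\<close> for \<open>b\<^sup>+ b'\<^sup>+\<close> gives a path from \<open>b\<close> to \<open>b'\<close>. One of
  its two parts keeps the orientation of \<open>C\<close>, and only the attached vertices in that part are
  used; by symmetry in \<open>b, b'\<close> it may be either part.\<close>

lemma dominating_adj_succ: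
  assumes b: "dominating b" "dominating b'" "b \<noteq> b'" "succ b \<rightarrow> succ b'"
  shows "card attach \<le> 12"
proof -
  obtain us vs where D: "rotation (us @ vs)" and usvs: "us \<noteq> []" "vs \<noteq> []"
    "last us = b'" "last vs = b" "hd us = succ b" "hd vs = succ b'"
    using successors_split[of b b'] b unfolding dominating_def by blast
  have half: "card (attach \<inter> set us) \<le> 6"
    if D: "rotation (us @ vs)" and b: "dominating b" "dominating b'" "succ b \<rightarrow> succ b'"
      and usvs: "us \<noteq> []" "vs \<noteq> []" "last us = b'" "last vs = b" "hd us = succ b" "hd vs = succ b'"
    for us vs b b'
  proof -
    have dist: "distinct (us @ vs)" using rotationD(2)[OF D] .
    \<comment> \<open>The path is \<open>rev vs @ us\<close>: back from \<open>b\<close> to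
      \<open>succ b'\<close>, then forward from \<open>succ b\<close> to \<open>b'\<close>. Its last
      vertex \<open>b'\<close> is left out.\<close>
    have "card (attach \<inter> set us - {b'}) \<le> 5"
    proof (rule no_crossing)
      show "successively (dominates G) (rev vs @ us)"
        using successively_adj_rev[of vs] rotationD(3)[OF D] usvs b graph_symmetric
        by (auto simp: successively_append_iff last_rev)
      show "set (rev vs @ us) = set C" using rotationD(4)[OF D] by auto
      fix x assume x: "x \<in> attach \<inter> set us - {b'}"
      then obtain as bs where us: "us = as @ x # bs" by (auto dest: split_list)
      then have bs: "bs \<noteq> []" using x usvs(3) by auto
      have "nxt (us @ vs) x = hd bs" using nxt_append[of "as @ [x]" "bs @ vs"] dist bs us by auto
      then have "succ x = hd bs" using D x by (auto simp: rotation_def attach_def)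
      then show "\<exists>xs ys. rev vs @ us = xs @ ys \<and> xs \<noteq> [] \<and> ys \<noteq> [] \<and> last xs = x \<and> hd ys = succ x"
        using us bs by (intro exI[of _ "rev vs @ as @ [x]"] exI[of _ bs]) auto
    qed (use dist b usvs in \<open>auto simp: dominating_def hd_rev\<close>)
    then show ?thesis
      using finite_attach by (simp add: card_Diff_singleton_if split: if_splits)
  qed
  have "attach = (attach \<inter> set us) \<union> (attach \<inter> set vs)"
    using rotationD(4)[OF D] by (auto simp: attach_def)
  then have "card attach \<le> card (attach \<inter> set us) + card (attach \<inter> set vs)"
    using card_Un_le by metis
  moreover have "card (attach \<inter> set us) \<le> 6" using half[OF D] b usvs by blast
  moreover have "card (attach \<inter> set vs) \<le> 6"
    using half[OF rotation_rotate[OF D], of b' b] b usvs graph_symmetric by blast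
  ultimately show ?thesis by linarith
qed

end

section \<open>From vertex lists to cycles of arcs\<close>

lemma (in wf_digraph) successively_adj_imp_arcs:
  assumes "successively (dominates G) (u # vs)"
  shows "\<exists>p. set p \<subseteq> arcs G \<and> cas u p (last (u # vs)) \<and> awalk_verts u p = u # vs
    \<and> map (tail G) p = butlast (u # vs)"
  using assms
proof (induction vs arbitrary: u)
  case Nil
  then show ?case by (intro exI[of _ "[]"]) auto
next
  case (Cons v vs)
  then obtain e where e: "e \<in> arcs G" "tail G e = u" "head G e = v" by auto
  obtain p where "set p \<subseteq> arcs G" "cas v p (last (v # vs))" "awalk_verts v p = v # vs"
    "map (tail G) p = butlast (v # vs)"
    using Cons by auto
  then show ?case using e by (intro exI[of _ "e # p"]) auto
qed

lemma (in wf_digraph) hamiltonian_vcycle: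
  assumes "vcycle xs" "3 \<le> length xs" "set xs = verts G"
  shows "hamiltonian G"
proof -
  obtain x ys where xs: "xs = x # ys" using assms(2) by (cases xs) auto
  then have "ys \<noteq> []" using assms(2) by auto
  then have "successively (dominates G) (xs @ [x])"
    unfolding successively_append_iff using assms xs by (simp add: vcycle_def)
  then have "\<exists>p. set p \<subseteq> arcs G \<and> cas x p x \<and> awalk_verts x p = xs @ [x] \<and> map (tail G) p = xs"
    using successively_adj_imp_arcs[of x "ys @ [x]"] by (simp add: xs butlast_append)
  then obtain p where p: "set p \<subseteq> arcs G" "cas x p x" "awalk_verts x p = xs @ [x]"
    "map (tail G) p = xs" by blast
  have "length p = length xs" using p(4) by (metis length_map)
  moreover have "tail G ` set p = verts G" using p(4) assms(3) by (metis set_map)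
  moreover have "awalk x p x" using p assms(3) xs by (auto simp: awalk_def)
  moreover have "distinct (tl (awalk_verts x p))"
    using p(3) xs assms(1) by (auto simp: vcycle_def)
  ultimately have "cycle p" "3 \<le> length p"
    using assms(2) by (auto simp: cycle_def)
  then show ?thesis using \<open>tail G ` set p = verts G\<close> by (auto simp: hamiltonian_def)
qed

lemma (in graph) longest_vcycle_exists:
  assumes "verts G \<noteq> {}"
  obtains C where "vcycle C" "\<And>D. vcycle D \<Longrightarrow> length D \<le> length C"
proof -
  obtain x where "x \<in> verts G" using assms by blast
  then have "vcycle [x]" by (simp add: vcycle_def)
  moreover have "length D < Suc (card (verts G))" if "vcycle D" for D
    using that card_mono[OF finite_verts, of "set D"]
    by (simp add: vcycle_def distinct_card less_Suc_eq_le)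
  ultimately show ?thesis using that ex_has_greatest_nat[of vcycle "[x]" length] by blast
qed

subsection \<open>Vertices with few neighbours in an independent set\<close>

text \<open>\<open>a\<close>, \<open>u\<close>, \<open>b\<close> induce a path, so three vertices of
  \<open>A\<close> missed by \<open>u\<close> would complete the forbidden subgraph.\<close>

lemma (in graph) independent_set_dichotomy:
  assumes free: "induced_free (with_proj P3_union_3P1) G"
    and A: "A \<subseteq> verts G" "\<And>a b. a \<in> A \<Longrightarrow> b \<in> A \<Longrightarrow> \<not> a \<rightarrow> b"
    and u: "a \<in> A" "b \<in> A" "a \<noteq> b" "u \<rightarrow> a" "u \<rightarrow> b"
  shows "card {x \<in> A. \<not> u \<rightarrow> x} \<le> 2"
proof (rule ccontr)
  assume "\<not> ?thesis"
  then have "3 \<le> card {x \<in> A. \<not> u \<rightarrow> x}" by simp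
  moreover have "u \<notin> A" using u A(2) by blast
  ultimately show False
    using P3_union_3P1_free_forbidden[OF free, of a u b "{x \<in> A. \<not> u \<rightarrow> x}"] u A graph_symmetric
    by blast
qed

text \<open>Otherwise \<open>p\<close>, \<open>q\<close>, \<open>r\<close> induce a path. Each of
  them equals or sees at most one vertex of \<open>A\<close>, so at least 6 - 3 vertices of
  \<open>A\<close> remain as isolated ones.\<close>

lemma (in graph) few_neighbours_P3_free:
  assumes free: "induced_free (with_proj P3_union_3P1) G"
    and A: "A \<subseteq> verts G" "\<And>a b. a \<in> A \<Longrightarrow> b \<in> A \<Longrightarrow> \<not> a \<rightarrow> b" "6 \<le> card A"
    and few: "\<And>u a b. u \<in> {p, q, r} \<Longrightarrow> a \<in> A \<Longrightarrow> b \<in> A \<Longrightarrow> u \<rightarrow> a \<Longrightarrow> u \<rightarrow> b \<Longrightarrow> a = b"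
    and adj: "p \<rightarrow> q" "q \<rightarrow> r" "p \<noteq> r"
  shows "p \<rightarrow> r"
proof (rule ccontr)
  assume nadj: "\<not> p \<rightarrow> r"
  define T where "T u = {a \<in> A. a = u \<or> u \<rightarrow> a}" for u
  have fin: "finite A" using A(1) finite_verts finite_subset by blast
  have T: "card (T u) \<le> 1" if "u \<in> {p, q, r}" for u
    using few[OF that] A(2) fin unfolding T_def One_nat_def
    by (subst card_le_Suc0_iff_eq) auto
  have "card (T p \<union> T q \<union> T r) \<le> card (T p) + card (T q) + card (T r)"
    by (meson add_right_mono card_Un_le le_trans)
  then have "card (T p \<union> T q \<union> T r) \<le> 3" using T[of p] T[of q] T[of r] by simp
  then have "3 \<le> card (A - (T p \<union> T q \<union> T r))"
    using diff_card_le_card_Diff[of "T p \<union> T q \<union> T r" A] fin A(3) by (simp add: T_def)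
  then show False
    using P3_union_3P1_free_forbidden[OF free, of p q r "A - (T p \<union> T q \<union> T r)"] adj nadj A
    unfolding T_def by blast
qed

section \<open>The toughness argument\<close>

lemma (in graph) tough_P3_union_3P1_free_hamiltonian:
  assumes n: "card (verts G) \<ge> 3"
    and tough: "tough 15 G"
    and free: "induced_free (with_proj P3_union_3P1) G"
  shows "hamiltonian G"
proof -
  have "verts G \<noteq> {}" using n by auto
  then obtain C where C: "vcycle C" "\<And>D. vcycle D \<Longrightarrow> length D \<le> length C"
    using longest_vcycle_exists by blast
  have "set C = verts G"
  proof (rule ccontr)
    assume "set C \<noteq> verts G"
    then obtain v where v: "v \<in> verts G - set C" using C(1) by (auto simp: vcycle_def)
    let ?D = "delete_verts G (set C)"
    interpret D: graph ?D by (rule graph_delete_verts)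
    define H where "H = {u. v \<rightarrow>\<^sup>*\<^bsub>?D\<^esub> u}"
    have vH: "v \<in> H" using v by (simp add: H_def)
    have H_verts: "H \<subseteq> verts G - set C" by (auto simp: H_def elim: reachable_in_vertsE)
    have H_closed: "w \<in> H" if "u \<in> H" "u \<rightarrow> w" "w \<notin> set C" for u w
      using that H_verts delete_verts_adj_iff[of u w "set C"] D.reachable_adj_trans by (auto simp: H_def)
    interpret longest_vcycle G C H
    proof unfold_locales
      fix x y assume xy: "x \<in> H" "y \<in> H"
      then have "x \<rightarrow>\<^sup>*\<^bsub>?D\<^esub> y"
        unfolding H_def using symmetric_reachable[OF D.sym_arcs] D.reachable_trans by blast
      then obtain p where p: "p \<noteq> []" "hd p = x" "last p = y" "distinct p"
        "set p \<subseteq> {z. x \<rightarrow>\<^sup>*\<^bsub>?D\<^esub> z}" "successively (dominates ?D) p"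
        using D.reachable_simple_path by blast
      moreover have "set p \<subseteq> H"
        using p(5) xy(1) D.reachable_trans unfolding H_def by blast
      moreover have "successively (dominates G) p"
        using p(6) by (rule successively_mono) (simp add: delete_verts_adj_iff)
      ultimately show "\<exists>p. p \<noteq> [] \<and> hd p = x \<and> last p = y \<and> distinct p \<and> set p \<subseteq> H
        \<and> successively (dominates G) p" by blast
    qed (use C H_verts in auto)
    have C_ne: "C \<noteq> []" using C(1) by (simp add: vcycle_def)
    have attach_not: "u \<in> H \<Longrightarrow> x \<in> attach \<Longrightarrow> \<not> u \<rightarrow> succ x" for u x
      using succ_not_attach[of x] succ_in[of x] attach_subset graph_symmetric
      unfolding attach_def by blast

    interpret GA: graph "delete_verts G attach" by (rule graph_delete_verts)
    \<comment> \<open>A path from \<open>v\<close> can leave \<open>H\<close> only into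
      \<open>attach\<close>, which has been deleted.\<close>
    have sep: "\<not> v \<rightarrow>\<^sup>*\<^bsub>delete_verts G attach\<^esub> c" if "c \<in> set C" for c
    proof
      assume "v \<rightarrow>\<^sup>*\<^bsub>delete_verts G attach\<^esub> c"
      then have "c \<in> H"
      proof (induction rule: GA.reachable_induct)
        case (step x y)
        then have "x \<rightarrow> y" "y \<notin> attach" by (auto simp: delete_verts_adj_iff)
        then show ?case using step(3) H_closed[of x y] graph_symmetric[of x y] by (auto simp: attach_def)
      qed (rule vH)
      then show False using that H_verts by blast
    qed
    \<comment> \<open>Not all of \<open>C\<close> is attached: of a vertex and its successor, at
      most one is.\<close>
    obtain c where c: "c \<in> set C" "c \<notin> attach"
      using C_ne succ_in succ_not_attach by (metis last_in_set)
    have "c \<in> verts G - attach" "attach \<subseteq> verts G" "v \<in> verts G - attach"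
      using c v C(1) attach_subset by (auto simp: vcycle_def)
    then have "15 * real (card (components (delete_verts G attach))) \<le> real (card attach)"
      using tough_separated[OF tough] sep[OF c(1)] by blast
    moreover have "0 < card (components (delete_verts G attach))"
      using card_components_delete_verts_pos[of v attach] v attach_subset by auto
    ultimately have card_attach: "15 \<le> card attach" by linarith

    define A where "A = insert v (succ ` attach)"
    have succ_C: "succ ` attach \<subseteq> set C" using succ_in attach_subset by blast
    have A_verts: "A \<subseteq> verts G" using succ_C C(1) v by (auto simp: A_def vcycle_def)
    have A_indep: "\<not> a \<rightarrow> b" if "a \<in> A" "b \<in> A" for a b
      using that successors_not_adj attach_not[OF vH] graph_symmetric adj_not_same
      unfolding A_def by blast
    have "inj_on succ attach" using inj_on_succ attach_subset by (rule inj_on_subset)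
    then have "card (succ ` attach) = card attach" by (rule card_image)
    moreover have "card (succ ` attach) \<le> card A"
      unfolding A_def by (rule card_mono) (use finite_attach in auto)
    ultimately have card_A: "6 \<le> card A" using card_attach by linarith

    define B where "B = {u \<in> verts G. \<exists>a\<in>A. \<exists>b\<in>A. a \<noteq> b \<and> u \<rightarrow> a \<and> u \<rightarrow> b}"
    interpret GB: graph "delete_verts G B" by (rule graph_delete_verts)
    \<comment> \<open>Without induced paths on three vertices, reachability in \<open>G - B\<close>
      collapses to adjacency.\<close>
    have clique: "x = y \<or> x \<rightarrow> y" if "x \<rightarrow>\<^sup>*\<^bsub>delete_verts G B\<^esub> y" for x y
      using that
    proof (induction rule: GB.reachable_induct)
      case (step y z)
      then have yz: "y \<rightarrow> z" "y \<notin> B" "z \<notin> B" by (auto simp: delete_verts_adj_iff)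
      have "x \<notin> B" using step(1) by (auto elim: reachable_in_vertsE)
      have "x \<rightarrow> z" if "x \<rightarrow> y" "x \<noteq> z"
      proof (rule few_neighbours_P3_free[OF free A_verts A_indep card_A _ that(1) yz(1) that(2)])
        fix u a b assume u: "u \<in> {x, y, z}" "a \<in> A" "b \<in> A" "u \<rightarrow> a" "u \<rightarrow> b"
        then have "u \<in> verts G" by (auto dest: adj_in_verts)
        then show "a = b" using u \<open>x \<notin> B\<close> yz unfolding B_def by blast
      qed
      then show ?case using step(3) yz(1) by blast
    qed simp
    have B_C: "B \<subseteq> set C"
    proof
      fix u assume "u \<in> B"
      then obtain a b where ab: "u \<in> verts G" "a \<in> A" "b \<in> A" "a \<noteq> b" "u \<rightarrow> a" "u \<rightarrow> b"
        unfolding B_def by blast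
      show "u \<in> set C"
      proof (rule ccontr)
        assume u: "u \<notin> set C"
        show False
        \<comment> \<open>In \<open>H\<close>, the only possible neighbour in \<open>A\<close> is
          \<open>v\<close>. Outside \<open>H\<close> and \<open>C\<close>, \<open>v\<close> is
          excluded, so both neighbours would be successors.\<close>
        proof (cases "u \<in> H")
          case True
          then show False using ab attach_not unfolding A_def by blast
        next
          case False
          then have "\<not> u \<rightarrow> v" using H_closed[OF vH, of u] u graph_symmetric by blast
          then obtain x y where "x \<in> attach" "y \<in> attach" "a = succ x" "b = succ y"
            using ab unfolding A_def by blast
          then show False using outside_adj_successors[of x y u] ab u False by auto
        qed
      qed
    qed
    have B_dom: "dominating b" if b: "b \<in> B" for b
    proof -
      have "card {a \<in> A. \<not> b \<rightarrow> a} \<le> 2"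
        using b independent_set_dichotomy[OF free A_verts A_indep] unfolding B_def by blast
      moreover have "card {a \<in> succ ` attach. \<not> b \<rightarrow> a} \<le> card {a \<in> A. \<not> b \<rightarrow> a}"
        using finite_attach by (intro card_mono) (auto simp: A_def)
      ultimately show ?thesis using b B_C by (auto simp: dominating_def)
    qed
    have succ_B: "succ b \<in> verts G - B" if "b \<in> B" for b
    proof -
      have "succ b \<notin> B"
        using dominating_succ[OF B_dom[OF that]] B_dom[of "succ b"] card_attach by linarith
      moreover have "succ b \<in> set C" using succ_in that B_C by blast
      ultimately show ?thesis using C(1) by (auto simp: vcycle_def)
    qed

    let ?comp = "\<lambda>u. delete_verts G B \<restriction> {w. u \<rightarrow>\<^sup>*\<^bsub>delete_verts G B\<^esub> w}"
    \<comment> \<open>As \<open>A\<close> is independent, its members have no neighbours in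
      \<open>A\<close>; so \<open>v\<close> and \<open>succ x\<close> survive in
      \<open>G - B\<close>, in different cliques, and \<open>B\<close> is a cutset.\<close>
    have A_B: "A \<subseteq> verts G - B" using A_verts A_indep unfolding B_def by blast
    obtain x where x: "x \<in> attach" using card_attach by fastforce
    have "succ x \<noteq> v" using x succ_C v by auto
    then have "\<not> v \<rightarrow>\<^sup>*\<^bsub>delete_verts G B\<^esub> succ x"
      using clique[of v "succ x"] attach_not[OF vH x] by auto
    moreover have "v \<in> verts G - B" "succ x \<in> verts G - B" "B \<subseteq> verts G"
      using A_B x by (auto simp: A_def B_def)
    ultimately have "15 * real (card (components (delete_verts G B))) \<le> real (card B)"
      using tough_separated[OF tough] by blast
    moreover have "0 < card (components (delete_verts G B))"
      using card_components_delete_verts_pos[of v B] A_B by (auto simp: A_def)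
    ultimately have "card (components (delete_verts G B)) < card B" by linarith
    \<comment> \<open>Pigeonhole: there are fewer cliques than vertices of \<open>B\<close>, so two
      successors share one.\<close>
    moreover have "(\<lambda>b. ?comp (succ b)) ` B \<subseteq> components (delete_verts G B)"
      using GB.reachable_class_component succ_B by auto
    ultimately have "\<not> inj_on (\<lambda>b. ?comp (succ b)) B"
      using card_inj_on_le GB.finite_components by (metis not_le)
    then obtain b b' where b: "b \<in> B" "b' \<in> B" "b \<noteq> b'" "?comp (succ b) = ?comp (succ b')"
      unfolding inj_on_def by blast
    from b(4) have "verts (?comp (succ b)) = verts (?comp (succ b'))" by (rule arg_cong)
    moreover have "succ b' \<in> verts (?comp (succ b'))" using succ_B b(2) by auto
    ultimately have "succ b \<rightarrow>\<^sup>*\<^bsub>delete_verts G B\<^esub> succ b'"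
      unfolding induce_subgraph_verts by blast
    moreover have "succ b \<noteq> succ b'"
      using inj_on_eq_iff[OF inj_on_succ, of b b'] b(1-3) B_C by blast
    ultimately have "succ b \<rightarrow> succ b'" using clique by blast
    then show False
      using dominating_adj_succ[OF B_dom[OF b(1)] B_dom[OF b(2)] b(3)] card_attach by linarith
  qed
  moreover have "3 \<le> length C"
    using n C(1) \<open>set C = verts G\<close> distinct_card[of C] by (simp add: vcycle_def)
  ultimately show ?thesis using hamiltonian_vcycle C(1) by blast
qed

theorem theorem1p3:
  fixes G :: "('a, 'b) pre_digraph"
  assumes "graph G"
    and "card (verts G) \<ge> 3"
    and "tough 15 G"
    and "induced_free (with_proj P3_union_3P1) G"
  shows "hamiltonian G"
  using assms by (rule graph.tough_P3_union_3P1_free_hamiltonian)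

end
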